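(* Let $E\subseteq\mathscr X$ be any non-empty event and let $P(\cdot\vert\cdot)$ be any coherent full conditional prevision, with corresponding full previsional AD-model $M_P$. Then $$\mathrm R(M_P\vert E)=\Big\langle\mathscr G^{\{E\}}_{\geq0}\cup\big(\mathrm{posi}(\mathscr L_{P_E})+\mathscr G^{\{E\}}_{\geq0}\big)\,;\,-\Big(\mathscr G^{\{E\}}_{\gtrdot0}\cup\big(\mathrm{posi}(\mathscr L_{P_E})+\mathscr G^{\{E\}}_{\gtrdot0}\big)\Big)\Big\rangle .$$
   Context: $\mathscr X$ is a non-empty set; $\mathscr G$ is the real linear space of all gambles, i.e. bounded maps $f:\mathscr X\to\mathbb R$; $\mathbb I_B$ is the indicator of $B\subseteq\mathscr X$; real numbers are identified with constant gambles. $\mathscr G_{\geq0}=\{f:\inf f\geq0\}$, $\mathscr G_{\gtrdot0}=\{f:\inf f>0\}$. For non-empty $B$, $\inf(f\vert B)$ and $\sup(f\vert B)$ are the infimum and supremum of $f$ over $B$. $\mathscr G^{\{E\}}_{\geq0}=\{f\in\mathscr G:\inf(f\vert E)\geq0\}$, $\mathscr G^{\{E\}}_{\gtrdot0}=\{f\in\mathscr G:\inf(f\vert E)>0\}$. Sums and negatives of sets are elementwise (Minkowski); $\mathrm{posi}(B)$ is the set of all finite (non-empty) linear combinations of elements of $B$ with strictly positive coefficients. An assessment is a pair $A=\langle A_{\mathrm{acc}};A_{\mathrm{rej}}\rangle$ of subsets of $\mathscr G$; $A_{\mathrm{des}}=A_{\mathrm{acc}}\cap(-A_{\mathrm{rej}})$.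 A coherent full conditional prevision is a map $P(\cdot\vert\cdot):\mathscr G\times(\mathscr P(\mathscr X)\setminus\{\emptyset\})\to\mathbb R$ such that (CC1) $\inf(f\vert B)\leq P(f\vert B)\leq\sup(f\vert B)$; (CC2) $P(\lambda f+\mu g\vert B)=\lambda P(f\vert B)+\mu P(g\vert B)$; (CC3) $P(f\mathbb I_C\vert B)=P(f\vert B\cap C)P(\mathbb I_C\vert B)$ whenever $B\cap C\neq\emptyset$; for all $f,g\in\mathscr G$, $\lambda,\mu\in\mathbb R$ and events. Put $\mathscr L_P:=\{\mathbb I_B(f-P(f\vert B)+\epsilon):f\in\mathscr G,\emptyset\neq B\subseteq\mathscr X,\epsilon>0\}$ and $\mathscr L_{P_E}:=\{\mathbb I_C(f-P(f\vert C)+\epsilon):f\in\mathscr G,\emptyset\neq C\subseteq E,\epsilon>0\}$ ($P_E$ is the restriction of $P$ to conditioning events that are non-empty subsets of $E$). The full previsional AD-model of $P$ is $M_P:=\langle\mathscr G_{\geq0}\cup(\mathrm{posi}(\mathscr L_P)+\mathscr G_{\geq0});-(\mathscr G_{\gtrdot0}\cup(\mathrm{posi}(\mathscr L_P)+\mathscr G_{\gtrdot0}))\rangle$. For $E\subseteq\mathscr X$ and $W\subseteq\mathscr G$: $I_E:=\{f:\mathbb I_Ef=0\}$, $W\Vert E:=\{f:\mathbb I_Ef\in W\}$. The revision operator is $$\mathrm R(M\vert E):=\begin{cases}\langle M_{\mathrm{acc}}\Vert E;-(M_{\mathrm{des}}\Vert E\cup(\mathscr G_{\gtrdot0}+M_{\mathrm{acc}}\Vert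 E))\rangle&\text{if }0\notin M_{\mathrm{acc}}\Vert E+\mathscr G_{\gtrdot0}\\ \langle\mathscr G_{\geq0}+I_E;-(\mathscr G_{\gtrdot0}+I_E)\rangle&\text{if }0\in M_{\mathrm{acc}}\Vert E+\mathscr G_{\gtrdot0}\text{ and }0\notin\mathscr G_{\gtrdot0}+I_E\\ \langle\mathscr G;\mathscr G\rangle&\text{if }0\in\mathscr G_{\gtrdot0}+I_E.\end{cases}$$ *)

theory Defs
  imports
    "HOL-Analysis.Analysis"
    "HOL-Library.Set_Algebras"
    "HOL-Library.Function_Algebras"
begin

text \<open>
  The non-empty possibility space is the type \<^typ>\<open>'a\<close>, so events are arbitrary sets of
  type \<^typ>\<open>'a set\<close> and gambles are the bounded functions \<^typ>\<open>'a \<Rightarrow> real\<close>. Addition, negation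
  and zero of gambles are pointwise. On sets of gambles, \<open>+\<close> is the elementwise (Minkowski) sum.
  The elementwise negative is written \<open>uminus ` A\<close>, because \<open>- A\<close> is the set complement.
\<close>

definition gambles :: "('a \<Rightarrow> real) set" where
  "gambles = {f. bounded (range f)}"

text \<open>
  All infima and suprema below are of bounded functions over non-empty sets,
  so the conditionally complete \<open>Inf\<close> and \<open>Sup\<close> on the reals have their intended meaning.
\<close>

definition nonneg_on :: "'a set \<Rightarrow> ('a \<Rightarrow> real) set" where
  "nonneg_on E = {f \<in> gambles. (INF x\<in>E. f x) \<ge> 0}"

definition pos_on :: "'a set \<Rightarrow> ('a \<Rightarrow> real) set" where
  "pos_on E = {f \<in> gambles. (INF x\<in>E. f x) > 0}"

abbreviation nonneg_gambles :: "('a \<Rightarrow> real) set" where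
  "nonneg_gambles \<equiv> nonneg_on UNIV"

abbreviation pos_gambles :: "('a \<Rightarrow> real) set" where
  "pos_gambles \<equiv> pos_on UNIV"

definition posi :: "('a \<Rightarrow> real) set \<Rightarrow> ('a \<Rightarrow> real) set" where
  "posi A = {(\<lambda>x. \<Sum>k<n. c k * g k x) | (n :: nat) c g. n \<ge> 1 \<and> (\<forall>k<n. c k > 0 \<and> g k \<in> A)}"

text \<open>An assessment is the pair of its accepted and its rejected gambles.\<close>

type_synonym 'a assessment = "('a \<Rightarrow> real) set \<times> ('a \<Rightarrow> real) set"

definition acc :: "'a assessment \<Rightarrow> ('a \<Rightarrow> real) set" where
  "acc A = fst A"

definition rej :: "'a assessment \<Rightarrow> ('a \<Rightarrow> real) set" where
  "rej A = snd A"

definition des :: "'a assessment \<Rightarrow> ('a \<Rightarrow> real) set" where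
  "des A = acc A \<inter> uminus ` rej A"

text \<open>
  A conditional prevision is a total function \<^typ>\<open>('a \<Rightarrow> real) \<Rightarrow> 'a set \<Rightarrow> real\<close>, with \<open>P f B\<close>
  for \<open>P(f | B)\<close>. Its values at unbounded \<open>f\<close> or at empty \<open>B\<close> are unconstrained and never used.
\<close>

definition coherent_full_conditional_prevision ::
    "(('a \<Rightarrow> real) \<Rightarrow> 'a set \<Rightarrow> real) \<Rightarrow> bool" where
  "coherent_full_conditional_prevision P \<longleftrightarrow>
     (\<forall>f\<in>gambles. \<forall>B. B \<noteq> {} \<longrightarrow> (INF x\<in>B. f x) \<le> P f B \<and> P f B \<le> (SUP x\<in>B. f x)) \<and>
     (\<forall>f\<in>gambles. \<forall>g\<in>gambles. \<forall>l m :: real. \<forall>B. B \<noteq> {} \<longrightarrow>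
        P (\<lambda>x. l * f x + m * g x) B = l * P f B + m * P g B) \<and>
     (\<forall>f\<in>gambles. \<forall>B C. B \<inter> C \<noteq> {} \<longrightarrow>
        P (\<lambda>x. f x * indicator C x) B = P f (B \<inter> C) * P (indicator C) B)"

text \<open>
  The called-off gambles of \<open>P\<close> whose conditioning events are subsets of \<open>E\<close>;
  \<open>E = UNIV\<close> gives the ones for the unrestricted \<open>P\<close>.
\<close>

definition called_off_gambles ::
    "(('a \<Rightarrow> real) \<Rightarrow> 'a set \<Rightarrow> real) \<Rightarrow> 'a set \<Rightarrow> ('a \<Rightarrow> real) set" where
  "called_off_gambles P E =
     {(\<lambda>x. indicator B x * (f x - P f B + \<epsilon>)) | B f \<epsilon>.
        f \<in> gambles \<and> B \<noteq> {} \<and> B \<subseteq> E \<and> \<epsilon> > 0}"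

definition full_previsional_AD_model ::
    "(('a \<Rightarrow> real) \<Rightarrow> 'a set \<Rightarrow> real) \<Rightarrow> 'a assessment" where
  "full_previsional_AD_model P =
     (nonneg_gambles \<union> (posi (called_off_gambles P UNIV) + nonneg_gambles),
      uminus ` (pos_gambles \<union> (posi (called_off_gambles P UNIV) + pos_gambles)))"

definition null_gambles :: "'a set \<Rightarrow> ('a \<Rightarrow> real) set" where
  "null_gambles E = {f \<in> gambles. (\<lambda>x. indicator E x * f x) = 0}"

definition called_off_preimage ::
    "('a \<Rightarrow> real) set \<Rightarrow> 'a set \<Rightarrow> ('a \<Rightarrow> real) set"  (infixl "\<parallel>" 80) where
  "W \<parallel> E = {f \<in> gambles. (\<lambda>x. indicator E x * f x) \<in> W}"

definition revision :: "'a assessment \<Rightarrow> 'a set \<Rightarrow> 'a assessment" where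
  "revision M E =
     (if 0 \<notin> acc M \<parallel> E + pos_gambles then
        (acc M \<parallel> E, uminus ` (des M \<parallel> E \<union> (pos_gambles + acc M \<parallel> E)))
      else if 0 \<notin> pos_gambles + null_gambles E then
        (nonneg_gambles + null_gambles E, uminus ` (pos_gambles + null_gambles E))
      else (gambles, gambles))"

end

theory Submission
  imports Defs
begin

text \<open>
  If \<open>k\<close> is a positive combination of called-off gambles and \<open>A\<close> is the union of their
  conditioning events, then \<open>k\<close> vanishes off \<open>A\<close> and \<open>P(k|A) > 0\<close>. So if \<open>I\<^sub>E f\<close> dominates
  \<open>k\<close>, then \<open>P(f | A \<inter> E) P(E | A) = P(I\<^sub>E f | A) > 0\<close>, whence \<open>P(f | C) > 0\<close> for
  \<open>C = A \<inter> E\<close>, while \<open>f \<ge> 0\<close> on \<open>E - C\<close>. The finitely many gambles behind \<open>k\<close> can therefore be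
  replaced by the single called-off gamble \<open>I\<^sub>C (f - P(f|C) + \<epsilon>)\<close> with \<open>\<epsilon> \<le> P(f|C)\<close>, whose
  conditioning event lies within \<open>E\<close>. The same inequality \<open>P(f|C) > 0\<close> excludes that \<open>f\<close> is
  uniformly negative, so only the first case of the revision operator occurs.
\<close>

section \<open>Closure properties of bounded functions\<close>

lemma gambles_iff: "f \<in> gambles \<longleftrightarrow> (\<exists>M. \<forall>x. \<bar>f x\<bar> \<le> M)"
  by (auto simp: gambles_def bounded_iff)

lemma gambles_const: "(\<lambda>x. c) \<in> gambles"
  by (auto simp: gambles_iff)

lemma gambles_indicator: "indicator B \<in> gambles"
  unfolding gambles_iff by (rule exI[of _ 1]) (auto simp: indicator_def)

lemma gambles_add:
  assumes "f \<in> gambles" "g \<in> gambles"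
  shows "(\<lambda>x. f x + g x) \<in> gambles"
proof -
  obtain M N where "\<forall>x. \<bar>f x\<bar> \<le> M" "\<forall>x. \<bar>g x\<bar> \<le> N"
    using assms by (auto simp: gambles_iff)
  then have "\<forall>x. \<bar>f x + g x\<bar> \<le> M + N"
    by (meson abs_triangle_ineq add_mono order_trans)
  then show ?thesis by (auto simp: gambles_iff)
qed

lemma gambles_mult:
  assumes "f \<in> gambles" "g \<in> gambles"
  shows "(\<lambda>x. f x * g x) \<in> gambles"
proof -
  obtain M N where "\<forall>x. \<bar>f x\<bar> \<le> M" "\<forall>x. \<bar>g x\<bar> \<le> N"
    using assms by (auto simp: gambles_iff)
  then have "\<forall>x. \<bar>f x * g x\<bar> \<le> M * N"
    by (auto simp: abs_mult intro!: mult_mono intro: order_trans[OF abs_ge_zero])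
  then show ?thesis by (auto simp: gambles_iff)
qed

lemma gambles_diff:
  assumes "f \<in> gambles" "g \<in> gambles"
  shows "(\<lambda>x. f x - g x) \<in> gambles"
  using gambles_add[OF assms(1) gambles_mult[OF gambles_const[of "-1"] assms(2)]] by simp

text \<open>Covers the remainder left on replacing several called-off gambles by one: it is constant
  on the conditioning event and equal to \<open>f\<close> elsewhere.\<close>

lemma gambles_if_const:
  assumes "f \<in> gambles"
  shows "(\<lambda>x. if x \<in> C then c else f x) \<in> gambles"
proof -
  have "(\<lambda>x. indicator C x * (c - f x) + f x) \<in> gambles"
    by (intro gambles_mult gambles_add gambles_diff gambles_indicator gambles_const assms)
  moreover have "(\<lambda>x. indicator C x * (c - f x) + f x) = (\<lambda>x. if x \<in> C then c else f x)"
    by (auto simp: indicator_def)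
  ultimately show ?thesis by simp
qed

lemma gambles_sum:
  fixes n :: nat
  assumes "\<And>k. k < n \<Longrightarrow> g k \<in> gambles"
  shows "(\<lambda>x. \<Sum>k<n. c k * g k x) \<in> gambles"
  using assms by (induction n) (auto intro!: gambles_const gambles_add gambles_mult)

lemma bdd_image_gamble:
  assumes "f \<in> gambles"
  shows "bdd_below (f ` B)" "bdd_above (f ` B)"
proof -
  have "bounded (f ` B)"
    using assms unfolding gambles_def by (auto intro: bounded_subset)
  then show "bdd_below (f ` B)" "bdd_above (f ` B)"
    by (auto intro: bounded_imp_bdd_below bounded_imp_bdd_above)
qed

section \<open>Pointwise forms of the conditions on infima\<close>

lemma nonneg_on_iff:
  assumes "E \<noteq> {}"
  shows "f \<in> nonneg_on E \<longleftrightarrow> f \<in> gambles \<and> (\<forall>x\<in>E. 0 \<le> f x)"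
  using le_cINF_iff[OF assms bdd_image_gamble(1), of f 0] by (auto simp: nonneg_on_def)

text \<open>A positive infimum is stronger than pointwise positivity; the uniform bound
  \<open>d\<close> is the form in which it passes through sums and dominations.\<close>

lemma pos_on_iff:
  assumes "E \<noteq> {}"
  shows "f \<in> pos_on E \<longleftrightarrow> f \<in> gambles \<and> (\<exists>d>0. \<forall>x\<in>E. d \<le> f x)"
proof
  assume f: "f \<in> pos_on E"
  then have "\<forall>x\<in>E. (INF x\<in>E. f x) \<le> f x"
    by (auto simp: pos_on_def intro!: cINF_lower bdd_image_gamble)
  with f show "f \<in> gambles \<and> (\<exists>d>0. \<forall>x\<in>E. d \<le> f x)"
    by (auto simp: pos_on_def)
next
  assume "f \<in> gambles \<and> (\<exists>d>0. \<forall>x\<in>E. d \<le> f x)"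
  then obtain d where d: "f \<in> gambles" "d > 0" "\<forall>x\<in>E. d \<le> f x" by blast
  then have "d \<le> (INF x\<in>E. f x)"
    using assms by (intro cINF_greatest) auto
  with d show "f \<in> pos_on E" by (simp add: pos_on_def)
qed

lemma called_off_preimage_iff:
  "f \<in> W \<parallel> E \<longleftrightarrow> f \<in> gambles \<and> (\<lambda>x. indicator E x * f x) \<in> W"
  by (simp add: called_off_preimage_def)

section \<open>Positive hulls of called-off gambles\<close>

lemma called_off_gambles_subset: "called_off_gambles P E \<subseteq> gambles"
  by (auto simp: called_off_gambles_def
      intro!: gambles_mult gambles_indicator gambles_add gambles_diff gambles_const)

lemma posi_mono:
  assumes "A \<subseteq> B"
  shows "posi A \<subseteq> posi B"
  using assms unfolding posi_def by blast

lemma subset_posi: "A \<subseteq> posi A"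
proof
  fix a assume "a \<in> A"
  then show "a \<in> posi A"
    unfolding posi_def
    by (intro CollectI exI[of _ "1::nat"] exI[of _ "\<lambda>_. 1"] exI[of _ "\<lambda>_. a"]) auto
qed

lemma posi_subset_gambles:
  assumes "A \<subseteq> gambles"
  shows "posi A \<subseteq> gambles"
  using assms unfolding posi_def by (auto intro!: gambles_sum)

lemma called_off_gambles_mono:
  assumes "E \<subseteq> F"
  shows "called_off_gambles P E \<subseteq> called_off_gambles P F"
  using assms unfolding called_off_gambles_def by blast

text \<open>Every conditioning event lies within \<open>E\<close>, so each summand vanishes off
  \<open>E\<close>. Multiplication by the indicator of \<open>E\<close> therefore leaves such a
  \<open>k\<close> unchanged.\<close>

lemma posi_called_off_gambles_eq_0:
  assumes "k \<in> posi (called_off_gambles P E)" "x \<notin> E"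
  shows "k x = 0"
proof -
  obtain n :: nat and c g where k: "k = (\<lambda>x. \<Sum>i<n. c i * g i x)"
    and g: "\<forall>i<n. g i \<in> called_off_gambles P E"
    using assms(1) unfolding posi_def by blast
  have "g i x = 0" if "i < n" for i
    using g that assms(2) unfolding called_off_gambles_def by (force simp: indicator_def)
  then show ?thesis by (simp add: k)
qed

text \<open>
  The half of \<open>P(f|C)\<close> that is not spent as \<open>\<epsilon>\<close> keeps the remainder uniformly positive on \<open>C\<close>.
\<close>

lemma in_posi_called_off_gambles_plus:
  assumes f: "f \<in> gambles" and C: "C \<noteq> {}" "C \<subseteq> E" "P f C > 0"
    and S: "(\<lambda>x. if x \<in> C then P f C / 2 else f x) \<in> S"
  shows "f \<in> posi (called_off_gambles P E) + S"
proof -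
  define k where "k = (\<lambda>x. indicator C x * (f x - P f C + P f C / 2))"
  have "k \<in> called_off_gambles P E"
    unfolding called_off_gambles_def k_def using f C(1,2) half_gt_zero[OF C(3)] by blast
  then have "k \<in> posi (called_off_gambles P E)" using subset_posi by blast
  moreover have "f = k + (\<lambda>x. if x \<in> C then P f C / 2 else f x)"
    by (auto simp: k_def indicator_def fun_eq_iff)
  ultimately show ?thesis using S by (metis set_plus_intro)
qed

section \<open>Consequences of coherence\<close>

context
  fixes P :: "('a \<Rightarrow> real) \<Rightarrow> 'a set \<Rightarrow> real"
  assumes coherent: "coherent_full_conditional_prevision P"
begin

lemma prevision_ge:
  assumes "f \<in> gambles" "B \<noteq> {}" "\<And>x. x \<in> B \<Longrightarrow> d \<le> f x"
  shows "d \<le> P f B"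
proof -
  have "d \<le> (INF x\<in>B. f x)" using assms by (auto intro: cINF_greatest)
  also have "\<dots> \<le> P f B"
    using coherent assms(1,2) by (simp add: coherent_full_conditional_prevision_def)
  finally show ?thesis .
qed

lemma prevision_le:
  assumes "f \<in> gambles" "B \<noteq> {}" "\<And>x. x \<in> B \<Longrightarrow> f x \<le> d"
  shows "P f B \<le> d"
proof -
  have "P f B \<le> (SUP x\<in>B. f x)"
    using coherent assms(1,2) by (simp add: coherent_full_conditional_prevision_def)
  also have "\<dots> \<le> d" using assms by (auto intro: cSUP_least)
  finally show ?thesis .
qed

lemma prevision_linear:
  assumes "f \<in> gambles" "g \<in> gambles" "B \<noteq> {}"
  shows "P (\<lambda>x. l * f x + m * g x) B = l * P f B + m * P g B"
  using coherent assms by (simp add: coherent_full_conditional_prevision_def)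

text \<open>CC3 with the factors of the gamble swapped, to match the shape of called-off
  gambles.\<close>

lemma prevision_indicator:
  assumes "f \<in> gambles" "B \<inter> C \<noteq> {}"
  shows "P (\<lambda>x. indicator C x * f x) B = P f (B \<inter> C) * P (indicator C) B"
  using coherent assms
  by (simp add: coherent_full_conditional_prevision_def mult.commute[of "indicator _ _"])

lemma prevision_const:
  assumes "B \<noteq> {}"
  shows "P (\<lambda>x. c) B = c"
  using prevision_ge[OF gambles_const assms, of c c] prevision_le[OF gambles_const assms, of c c]
  by simp

lemma prevision_add_const:
  assumes "f \<in> gambles" "B \<noteq> {}"
  shows "P (\<lambda>x. f x + c) B = P f B + c"
  using prevision_linear[OF assms(1) gambles_const[of c] assms(2), of 1 1]
  by (simp add: prevision_const assms)

lemma prevision_sum: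
  fixes n :: nat
  assumes "\<And>k. k < n \<Longrightarrow> g k \<in> gambles" "B \<noteq> {}"
  shows "P (\<lambda>x. \<Sum>k<n. c k * g k x) B = (\<Sum>k<n. c k * P (g k) B)"
  using assms
proof (induction n)
  case 0
  then show ?case by (simp add: prevision_const)
next
  case (Suc n)
  have "(\<lambda>x. \<Sum>k<n. c k * g k x) \<in> gambles"
    using Suc.prems by (intro gambles_sum) auto
  then show ?case
    using Suc prevision_linear[of "\<lambda>x. \<Sum>k<n. c k * g k x" "g n" B 1 "c n"] by simp
qed

text \<open>CC3 applies with \<open>A \<inter> B = B\<close>, and given \<open>B\<close> the centred
  gamble \<open>f - P f B\<close> has prevision 0, so only \<open>\<epsilon>\<close>
  survives.\<close>

lemma prevision_called_off_gamble:
  assumes "f \<in> gambles" "B \<noteq> {}" "B \<subseteq> A"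
  shows "P (\<lambda>x. indicator B x * (f x - P f B + \<epsilon>)) A = \<epsilon> * P (indicator B) A"
proof -
  have "A \<inter> B = B" using assms by blast
  moreover have "P (\<lambda>x. f x - P f B + \<epsilon>) B = \<epsilon>"
    using prevision_add_const[OF assms(1,2), of "\<epsilon> - P f B"] by (simp add: algebra_simps)
  ultimately show ?thesis
    using assms prevision_indicator[of "\<lambda>x. f x - P f B + \<epsilon>" A B]
    by (simp add: gambles_add gambles_diff gambles_const)
qed

text \<open>Each summand has prevision a positive multiple of \<open>P (indicator (B i)) A\<close>.
  The events \<open>B i\<close> cover \<open>A\<close>, so these numbers cannot all be zero.\<close>

lemma posi_called_off_gambles_prevision_pos:
  assumes "k \<in> posi (called_off_gambles P E)"
  obtains A where "A \<noteq> {}" "\<And>x. x \<notin> A \<Longrightarrow> k x = 0" "P k A > 0"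
proof -
  obtain n :: nat and c g where n: "n \<ge> 1" and k: "k = (\<lambda>x. \<Sum>i<n. c i * g i x)"
    and cg: "\<forall>i<n. c i > 0 \<and> g i \<in> called_off_gambles P E"
    using assms unfolding posi_def by blast
  \<comment> \<open>Naming the representation lets a single choice pick \<open>B\<close>,
    \<open>f\<close> and \<open>\<epsilon>\<close> together for all indices.\<close>
  define Q where "Q h B f \<epsilon> \<longleftrightarrow> h = (\<lambda>x. indicator B x * (f x - P f B + \<epsilon>)) \<and>
      f \<in> gambles \<and> B \<noteq> {} \<and> \<epsilon> > 0" for h B f \<epsilon>
  have "\<exists>B f \<epsilon>. Q (g i) B f \<epsilon>" if "i < n" for i
  proof -
    have "g i \<in> called_off_gambles P E" using cg that by simp
    then show ?thesis unfolding called_off_gambles_def Q_def by blast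
  qed
  then obtain B f \<epsilon> where "\<And>i. i < n \<Longrightarrow> Q (g i) (B i) (f i) (\<epsilon> i)"
    by metis
  then have B: "g i = (\<lambda>x. indicator (B i) x * (f i x - P (f i) (B i) + \<epsilon> i)) \<and>
      f i \<in> gambles \<and> B i \<noteq> {} \<and> \<epsilon> i > 0" if "i < n" for i
    using that by (simp add: Q_def)
  define A where "A = (\<Union>i<n. B i)"
  have nonempty: "A \<noteq> {}" using B[of 0] n by (auto simp: A_def)
  have sub: "B i \<subseteq> A" if "i < n" for i using that by (auto simp: A_def)
  have g: "g i \<in> gambles" if "i < n" for i
    using cg that called_off_gambles_subset by blast
  have "k x = 0" if "x \<notin> A" for x
  proof -
    have "g i x = 0" if "i < n" for i
      using B[OF that] sub[OF that] \<open>x \<notin> A\<close> by (auto simp: indicator_def)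
    then show ?thesis by (simp add: k)
  qed
  moreover have "P k A > 0"
  proof -
    have nonneg: "0 \<le> P (indicator (B i)) A" for i
      using nonempty by (intro prevision_ge gambles_indicator) auto
    \<comment> \<open>Each point of \<open>A\<close> lies in some \<open>B j\<close>, so the
      indicators sum to at least 1 on \<open>A\<close>.\<close>
    have "1 \<le> P (\<lambda>x. \<Sum>i<n. 1 * indicator (B i) x) A"
    proof (intro prevision_ge gambles_sum gambles_indicator nonempty)
      fix x assume "x \<in> A"
      then obtain j where "j < n" "x \<in> B j" by (auto simp: A_def)
      then show "1 \<le> (\<Sum>i<n. 1 * indicator (B i) x :: real)"
        using member_le_sum[of j "{..<n}" "\<lambda>i. indicator (B i) x :: real"] by simp
    qed
    then have "1 \<le> (\<Sum>i<n. P (indicator (B i)) A)"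
      using prevision_sum[of n "\<lambda>i. indicator (B i)" A "\<lambda>_. 1"] nonempty
      by (simp add: gambles_indicator)
    \<comment> \<open>If no summand were positive, the sum would be at most 0.\<close>
    then obtain j where j: "j < n" "P (indicator (B j)) A > 0"
      using sum_nonpos[of "{..<n}" "\<lambda>i. P (indicator (B i)) A"]
      by (metis lessThan_iff not_le order_less_le_trans zero_less_one)
    have "P k A = (\<Sum>i<n. c i * P (g i) A)"
      unfolding k by (intro prevision_sum g nonempty)
    also have "\<dots> = (\<Sum>i<n. c i * (\<epsilon> i * P (indicator (B i)) A))"
    proof (rule sum.cong[OF refl])
      fix i assume "i \<in> {..<n}"
      then have "i < n" by simp
      then show "c i * P (g i) A = c i * (\<epsilon> i * P (indicator (B i)) A)"
        using B[of i] prevision_called_off_gamble[OF _ _ sub, of "f i" i "\<epsilon> i"] by simp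
    qed
    also have "\<dots> > 0"
    proof (rule sum_pos2[of _ j])
      show "0 < c j * (\<epsilon> j * P (indicator (B j)) A)" using cg B j by simp
      show "0 \<le> c i * (\<epsilon> i * P (indicator (B i)) A)" if "i \<in> {..<n}" for i
        using that cg B[of i] by (intro mult_nonneg_nonneg nonneg) (simp_all add: less_imp_le)
    qed (use j in auto)
    finally show ?thesis .
  qed
  ultimately show thesis using nonempty that by blast
qed

text \<open>The bound \<open>d\<close> is 0 for accepted gambles and positive for desirable ones.
  \<open>F\<close> stays free: it is \<open>UNIV\<close> for gambles of the model and
  \<open>E\<close> when consistency of the revised model is shown. \<open>C\<close> is
  \<open>A \<inter> E\<close>, with \<open>A\<close> from the preceding lemma.\<close>

lemma dominating_prevision_pos:
  assumes f: "f \<in> gambles" and k: "k \<in> posi (called_off_gambles P F)"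
    and d: "d \<ge> 0" and le: "\<And>x. k x + d \<le> indicator E x * f x"
  obtains C where "C \<noteq> {}" "C \<subseteq> E" "P f C > 0" "\<And>x. x \<in> E - C \<Longrightarrow> d \<le> f x"
proof -
  define g where "g = (\<lambda>x. indicator E x * f x)"
  have g: "g \<in> gambles"
    unfolding g_def by (intro gambles_mult gambles_indicator f)
  have k': "k \<in> gambles"
    using k posi_subset_gambles[OF called_off_gambles_subset] by blast
  obtain A where A: "A \<noteq> {}" "\<And>x. x \<notin> A \<Longrightarrow> k x = 0" "P k A > 0"
    using posi_called_off_gambles_prevision_pos[OF k] by blast
  \<comment> \<open>Domination makes \<open>g - k\<close> nonnegative, so by linearity
    \<open>P g A \<ge> P k A\<close>. The coefficients 1 and -1 fit
    \<open>prevision_linear\<close>.\<close>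
  have "0 \<le> P (\<lambda>x. 1 * g x + (-1) * k x) A"
  proof (rule prevision_ge)
    show "(\<lambda>x. 1 * g x + (-1) * k x) \<in> gambles"
      by (intro gambles_add gambles_mult gambles_const g k')
    show "0 \<le> 1 * g x + (-1) * k x" for x
      using le[of x] d by (simp add: g_def)
  qed (rule A)
  then have pos: "P g A > 0"
    using prevision_linear[OF g k' A(1), of 1 "-1"] A(3) by simp
  \<comment> \<open>Otherwise \<open>g\<close> would vanish on all of \<open>A\<close>; CC3 requires
    this intersection to be nonempty.\<close>
  have nonempty: "A \<inter> E \<noteq> {}"
  proof
    assume "A \<inter> E = {}"
    then have "P g A \<le> 0"
      by (intro prevision_le g A) (auto simp: g_def indicator_def)
    with pos show False by simp
  qed
  have "0 \<le> P (indicator E) A"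
    by (intro prevision_ge gambles_indicator A) auto
  moreover have "P f (A \<inter> E) * P (indicator E) A > 0"
    using pos prevision_indicator[OF f nonempty] by (simp add: g_def)
  ultimately have "P f (A \<inter> E) > 0"
    by (simp add: zero_less_mult_iff)
  \<comment> \<open>Off \<open>A\<close> the gamble \<open>k\<close> is 0, so the domination reduces
    to \<open>d \<le> f x\<close> on the rest of \<open>E\<close>.\<close>
  moreover have "d \<le> f x" if "x \<in> E - A \<inter> E" for x
    using le[of x] A(2)[of x] that by auto
  ultimately show thesis using nonempty that[of "A \<inter> E"] by blast
qed

lemma in_posi_plus_nonneg:
  assumes f: "f \<in> gambles" and k: "k \<in> posi (called_off_gambles P F)"
    and le: "\<And>x. k x \<le> indicator E x * f x" and E: "E \<noteq> {}"
  shows "f \<in> posi (called_off_gambles P E) + nonneg_on E"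
proof -
  obtain C where C: "C \<noteq> {}" "C \<subseteq> E" "P f C > 0" "\<And>x. x \<in> E - C \<Longrightarrow> 0 \<le> f x"
    using dominating_prevision_pos[OF f k order_refl, of E] le by auto
  show ?thesis
    using C by (intro in_posi_called_off_gambles_plus[of f C _ P, OF f C(1-3)])
      (auto simp: nonneg_on_iff[OF E] intro!: gambles_if_const f)
qed

lemma in_posi_plus_pos:
  assumes f: "f \<in> gambles" and k: "k \<in> posi (called_off_gambles P F)" and d: "d > 0"
    and le: "\<And>x. k x + d \<le> indicator E x * f x" and E: "E \<noteq> {}"
  shows "f \<in> posi (called_off_gambles P E) + pos_on E"
proof -
  obtain C where C: "C \<noteq> {}" "C \<subseteq> E" "P f C > 0" "\<And>x. x \<in> E - C \<Longrightarrow> d \<le> f x"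
    using dominating_prevision_pos[OF f k less_imp_le[OF d] le] by blast
  \<comment> \<open>The modified gamble is \<open>P f C / 2\<close> on \<open>C\<close> and at least
    \<open>d\<close> on the rest of \<open>E\<close>; the smaller value bounds it uniformly.\<close>
  have "\<exists>e>0. \<forall>x\<in>E. e \<le> (if x \<in> C then P f C / 2 else f x)"
    using C d by (intro exI[of _ "min d (P f C / 2)"]) (auto simp: min_le_iff_disj)
  then show ?thesis
    by (intro in_posi_called_off_gambles_plus[of f C _ P, OF f C(1-3)])
      (auto simp: pos_on_iff[OF E] intro!: gambles_if_const f)
qed

section \<open>Accepted and desirable gambles called off outside \<open>E\<close>\<close>

lemma acc_called_off_preimage:
  assumes E: "E \<noteq> {}"
  shows "acc (full_previsional_AD_model P) \<parallel> E =
    nonneg_on E \<union> (posi (called_off_gambles P E) + nonneg_on E)" (is "?L = ?R")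
proof (intro equalityI subsetI)
  fix f assume "f \<in> ?L"
  then have f: "f \<in> gambles" and "(\<lambda>x. indicator E x * f x) \<in> nonneg_gambles \<or>
      (\<lambda>x. indicator E x * f x) \<in> posi (called_off_gambles P UNIV) + nonneg_gambles"
    by (auto simp: called_off_preimage_iff acc_def full_previsional_AD_model_def)
  then show "f \<in> ?R"
  proof (elim disjE)
    assume "(\<lambda>x. indicator E x * f x) \<in> nonneg_gambles"
    then have "\<forall>x. 0 \<le> indicator E x * f x" by (simp add: nonneg_on_iff)
    then have "\<forall>x\<in>E. 0 \<le> f x" by (metis indicator_simps(1) mult_1)
    with f show ?thesis by (simp add: nonneg_on_iff E)
  next
    assume "(\<lambda>x. indicator E x * f x) \<in> posi (called_off_gambles P UNIV) + nonneg_gambles"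
    then obtain k h where eq: "(\<lambda>x. indicator E x * f x) = k + h"
      and k: "k \<in> posi (called_off_gambles P UNIV)" and h: "h \<in> nonneg_gambles"
      by (rule set_plus_elim)
    have "k x \<le> indicator E x * f x" for x
      using fun_cong[OF eq, of x] h by (simp add: nonneg_on_iff)
    then show ?thesis using in_posi_plus_nonneg[OF f k _ E] by blast
  qed
next
  fix f assume "f \<in> ?R"
  then show "f \<in> ?L"
  proof
    assume "f \<in> nonneg_on E"
    then have f: "f \<in> gambles" "\<forall>x\<in>E. 0 \<le> f x" by (auto simp: nonneg_on_iff E)
    then have "(\<lambda>x. indicator E x * f x) \<in> nonneg_gambles"
      unfolding nonneg_on_iff[OF UNIV_not_empty]
      by (intro conjI gambles_mult gambles_indicator) (auto simp: indicator_def)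
    with f show ?thesis
      by (simp add: called_off_preimage_iff acc_def full_previsional_AD_model_def)
  next
    assume "f \<in> posi (called_off_gambles P E) + nonneg_on E"
    then obtain k h where f: "f = k + h"
      and k: "k \<in> posi (called_off_gambles P E)" and h: "h \<in> nonneg_on E"
      by (rule set_plus_elim)
    have h': "h \<in> gambles" "\<forall>x\<in>E. 0 \<le> h x" using h by (auto simp: nonneg_on_iff E)
    have k': "k \<in> gambles"
      using k posi_subset_gambles[OF called_off_gambles_subset] by blast
    \<comment> \<open>Since \<open>k\<close> already vanishes off \<open>E\<close>, the indicator
      only changes \<open>h\<close>.\<close>
    have "(\<lambda>x. indicator E x * f x) = k + (\<lambda>x. indicator E x * h x)"
      using posi_called_off_gambles_eq_0[OF k] by (auto simp: f fun_eq_iff indicator_def)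
    moreover have "(\<lambda>x. indicator E x * h x) \<in> nonneg_gambles"
      unfolding nonneg_on_iff[OF UNIV_not_empty]
      using h' by (intro conjI gambles_mult gambles_indicator) (auto simp: indicator_def)
    moreover have "k \<in> posi (called_off_gambles P UNIV)"
      using k posi_mono[OF called_off_gambles_mono[of E UNIV P]] by blast
    ultimately have "(\<lambda>x. indicator E x * f x) \<in>
        posi (called_off_gambles P UNIV) + nonneg_gambles"
      by (metis set_plus_intro)
    moreover have "f \<in> gambles" using gambles_add[OF k' h'(1)] by (simp add: f plus_fun_def)
    ultimately show ?thesis
      by (simp add: called_off_preimage_iff acc_def full_previsional_AD_model_def)
  qed
qed

text \<open>An inclusion suffices: \<open>revision\<close> unites this set with the sum of
  \<open>pos_gambles\<close> and the accepted part, which is already the whole right-hand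
  side.\<close>

lemma des_called_off_preimage_subset:
  assumes E: "E \<noteq> {}"
  shows "des (full_previsional_AD_model P) \<parallel> E \<subseteq>
    pos_on E \<union> (posi (called_off_gambles P E) + pos_on E)"
proof
  fix f assume "f \<in> des (full_previsional_AD_model P) \<parallel> E"
  then have f: "f \<in> gambles" and "(\<lambda>x. indicator E x * f x) \<in> pos_gambles \<or>
      (\<lambda>x. indicator E x * f x) \<in> posi (called_off_gambles P UNIV) + pos_gambles"
    by (auto simp: called_off_preimage_iff des_def rej_def full_previsional_AD_model_def)
  then show "f \<in> pos_on E \<union> (posi (called_off_gambles P E) + pos_on E)"
  proof (elim disjE)
    assume "(\<lambda>x. indicator E x * f x) \<in> pos_gambles"
    then obtain d where d: "d > 0" "\<forall>x. d \<le> indicator E x * f x" by (auto simp: pos_on_iff)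
    then have "\<forall>x\<in>E. d \<le> f x" by (metis indicator_simps(1) mult_1)
    with f d show ?thesis by (auto simp: pos_on_iff E)
  next
    assume "(\<lambda>x. indicator E x * f x) \<in> posi (called_off_gambles P UNIV) + pos_gambles"
    then obtain k h where eq: "(\<lambda>x. indicator E x * f x) = k + h"
      and k: "k \<in> posi (called_off_gambles P UNIV)" and h: "h \<in> pos_gambles"
      by (rule set_plus_elim)
    obtain d where d: "d > 0" "\<forall>x. d \<le> h x" using h by (auto simp: pos_on_iff)
    have "k x + d \<le> indicator E x * f x" for x
      using fun_cong[OF eq, of x] d by simp
    then show ?thesis using in_posi_plus_pos[OF f k d(1) _ E] by blast
  qed
qed

end

section \<open>Assembling the revised model\<close>

lemma pos_gambles_plus_nonneg_on:
  assumes E: "E \<noteq> {}"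
  shows "pos_gambles + nonneg_on E = pos_on E"
proof (intro equalityI subsetI)
  fix f :: "'a \<Rightarrow> real" assume "f \<in> pos_gambles + nonneg_on E"
  then obtain h u where f: "f = h + u" and h: "h \<in> pos_gambles" and u: "u \<in> nonneg_on E"
    by (rule set_plus_elim)
  obtain d where d: "d > 0" "\<forall>x. d \<le> h x" using h by (auto simp: pos_on_iff)
  have "\<forall>x\<in>E. d \<le> f x" using d u by (auto simp: f nonneg_on_iff E intro: add_increasing2)
  moreover have "f \<in> gambles"
    using gambles_add[of h u] h u by (simp add: f plus_fun_def nonneg_on_def pos_on_def)
  ultimately show "f \<in> pos_on E" using d by (auto simp: pos_on_iff E)
next
  fix f :: "'a \<Rightarrow> real" assume "f \<in> pos_on E"
  then obtain d where f: "f \<in> gambles" and d: "d > 0" "\<forall>x\<in>E. d \<le> f x"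
    by (auto simp: pos_on_iff E)
  \<comment> \<open>The constant \<open>d\<close> is split off on the whole space; the remainder
    \<open>f - d\<close> is constrained only on \<open>E\<close>.\<close>
  have "(\<lambda>x. d) \<in> pos_gambles" using d by (auto simp: pos_on_iff gambles_const)
  moreover have "(\<lambda>x. f x - d) \<in> nonneg_on E"
    using f d by (auto simp: nonneg_on_iff E gambles_diff gambles_const)
  moreover have "f = (\<lambda>x. d) + (\<lambda>x. f x - d)" by (simp add: fun_eq_iff)
  ultimately show "f \<in> pos_gambles + nonneg_on E" by (metis set_plus_intro)
qed

theorem proposition20:
  fixes E :: "'a set" and P :: "('a \<Rightarrow> real) \<Rightarrow> 'a set \<Rightarrow> real"
  assumes "E \<noteq> {}"
    and "coherent_full_conditional_prevision P"
  shows "revision (full_previsional_AD_model P) E =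
    (nonneg_on E \<union> (posi (called_off_gambles P E) + nonneg_on E),
     uminus ` (pos_on E \<union> (posi (called_off_gambles P E) + pos_on E)))"
proof -
  let ?M = "full_previsional_AD_model P" and ?K = "posi (called_off_gambles P E)"
  note acc = acc_called_off_preimage[OF assms(2,1)]
  have sum: "pos_gambles + acc ?M \<parallel> E = pos_on E \<union> (?K + pos_on E)"
  proof -
    have distrib: "X + (Y \<union> Z) = (X + Y) \<union> (X + Z)" for X Y Z :: "('a \<Rightarrow> real) set"
      unfolding set_plus_def by blast
    have "pos_gambles + acc ?M \<parallel> E =
        (pos_gambles + nonneg_on E) \<union> (pos_gambles + (?K + nonneg_on E))"
      unfolding acc by (rule distrib)
    \<comment> \<open>Minkowski addition lets \<open>pos_gambles\<close> move past the hull and turn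
      \<open>nonneg_on E\<close> into \<open>pos_on E\<close>.\<close>
    also have "pos_gambles + (?K + nonneg_on E) = ?K + (pos_gambles + nonneg_on E)"
      by (rule add.left_commute)
    finally show ?thesis by (simp add: pos_gambles_plus_nonneg_on[OF assms(1)])
  qed
  have "0 \<notin> pos_on E \<union> (?K + pos_on E)"
  proof
    assume "0 \<in> pos_on E \<union> (?K + pos_on E)"
    then show False
    proof
      assume "0 \<in> pos_on E"
      then show False using assms(1) by (auto simp: pos_on_iff)
    next
      assume "0 \<in> ?K + pos_on E"
      then obtain k h where eq: "0 = k + h" and k: "k \<in> ?K" and h: "h \<in> pos_on E"
        by (rule set_plus_elim)
      \<comment> \<open>On \<open>E\<close>, \<open>k = - h \<le> 0\<close>; off \<open>E\<close>,
        \<open>k\<close> vanishes. So the zero gamble dominates \<open>k\<close>, which would force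
        \<open>P (\<lambda>x. 0) C > 0\<close> for some nonempty \<open>C\<close>.\<close>
      have le: "k x + 0 \<le> indicator E x * 0" for x
      proof (cases "x \<in> E")
        case True
        then have "0 \<le> h x" using h by (force simp: pos_on_iff[OF assms(1)])
        then show ?thesis using fun_cong[OF eq, of x] by simp
      next
        case False
        then show ?thesis using posi_called_off_gambles_eq_0[OF k] by simp
      qed
      obtain C where "C \<noteq> {}" "P (\<lambda>x. 0) C > 0"
        by (rule dominating_prevision_pos[OF assms(2) gambles_const k order_refl le])
      then show False by (simp add: prevision_const[OF assms(2)])
    qed
  qed
  \<comment> \<open>Up to commutativity this is the test in \<open>revision\<close>, so its first
    branch applies.\<close>
  then have "0 \<notin> acc ?M \<parallel> E + pos_gambles"
    by (simp add: add.commute[of "acc ?M \<parallel> E"] sum)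
  moreover have "des ?M \<parallel> E \<union> (pos_gambles + acc ?M \<parallel> E) = pos_on E \<union> (?K + pos_on E)"
    unfolding sum using des_called_off_preimage_subset[OF assms(2,1)] by blast
  ultimately show ?thesis by (simp add: revision_def acc)
qed

end
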